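(* Let $q=2^m$ for some integer $m\ge 2$. Consider the affine space $\mathbb{F}_q^3$ with its projective plane at infinity $\pi$. Fix a point $x\in\mathbb{F}_q^3$, and let $H^*$ be a set of $q+2$ lines of $\pi$ such that every point of $\pi$ lies on either $0$ or $2$ lines of $H^*$. Call a point of $\pi$ exterior if it lies on no line of $H^*$. Let $Y$ be the set of points $y\in\mathbb{F}_q^3$, $y\neq x$, such that the affine line through $x$ and $y$ meets $\pi$ in an exterior point, and let $Z$ be the set of affine planes of $\mathbb{F}_q^3$ whose line at infinity belongs to $H^*$ and which do not contain $x$. Let $G$ be the bipartite incidence graph on $Y\cup Z$ (a point is adjacent to a plane iff it lies on it). Then $G$ is distance-biregular with intersection array \[ \begin{vmatrix} q+2; & 1, & 2, & \frac{(q+1)q}{4}, & q+2 \\ \frac{q(q-1)}{2}; & 1, & \frac q2, & q+1, & \frac{q(q-1)}{2}\end{vmatrix}. \]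
   Context: A bipartite graph with bipartition $Y\cup Z$ is distance-biregular if for every vertex $a$, every $i$, and every vertex $w$ at distance $i$ from $a$, the numbers $c_i(a)=|\{u\sim w: d(a,u)=i-1\}|$ and $b_i(a)=|\{u\sim w: d(a,u)=i+1\}|$ depend only on $i$ and on which part contains $a$. The intersection array $\begin{vmatrix} k; & c_1^{Y}, & \dots, & c_{d_Y}^{Y} \\ \ell; & c_1^{Z}, & \dots, & c_{d_Z}^{Z}\end{vmatrix}$ records the valency $k$ of vertices in $Y$, the valency $\ell$ of vertices in $Z$, and the numbers $c_i$ (for vertices in $Y$, resp. $Z$) for $1\le i\le d_Y$ (resp. $d_Z$), the eccentricities of vertices in $Y$ (resp. $Z$). *)

theory Defs
  imports "HOL-Analysis.Cartesian_Space" "HOL-Library.Extended_Nat"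
begin

text \<open>
  A graph is given by its vertex set and a symmetric adjacency relation. Distances are extended
  naturals, so vertices in different components are at distance \<open>\<infinity>\<close>; in particular
  a finite eccentricity implies that every vertex is reachable.
\<close>

definition bipartite_graph :: "'v set \<Rightarrow> 'v set \<Rightarrow> ('v \<times> 'v) set \<Rightarrow> bool" where
  "bipartite_graph Y Z E \<longleftrightarrow>
     finite Y \<and> finite Z \<and> Y \<inter> Z = {} \<and> E \<subseteq> Y \<times> Z \<union> Z \<times> Y \<and> sym E"

definition valency :: "('v \<times> 'v) set \<Rightarrow> 'v \<Rightarrow> nat" where
  "valency E a = card {u. (a, u) \<in> E}"

definition gdist :: "('v \<times> 'v) set \<Rightarrow> 'v \<Rightarrow> 'v \<Rightarrow> enat" where
  "gdist E a w = (INF n \<in> {n. (a, w) \<in> E ^^ n}. enat n)"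

definition eccentricity :: "'v set \<Rightarrow> ('v \<times> 'v) set \<Rightarrow> 'v \<Rightarrow> enat" where
  "eccentricity V E a = (SUP w \<in> V. gdist E a w)"

text \<open>
  For \<open>w\<close> at distance \<open>i\<close> from \<open>a\<close> these are the numbers \<open>c\<^sub>i(a)\<close> and \<open>b\<^sub>i(a)\<close>. The condition
  \<open>d(a, u) = i - 1\<close> is written as \<open>d(a, u) + 1 = i\<close> because of truncated subtraction at \<open>i = 0\<close>.
\<close>

definition c_num :: "('v \<times> 'v) set \<Rightarrow> nat \<Rightarrow> 'v \<Rightarrow> 'v \<Rightarrow> nat" where
  "c_num E i a w = card {u. (w, u) \<in> E \<and> gdist E a u + 1 = enat i}"

definition b_num :: "('v \<times> 'v) set \<Rightarrow> nat \<Rightarrow> 'v \<Rightarrow> 'v \<Rightarrow> nat" where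
  "b_num E i a w = card {u. (w, u) \<in> E \<and> gdist E a u = enat (i + 1)}"

definition distance_biregular :: "'v set \<Rightarrow> 'v set \<Rightarrow> ('v \<times> 'v) set \<Rightarrow> bool" where
  "distance_biregular Y Z E \<longleftrightarrow>
     bipartite_graph Y Z E \<and>
     (\<forall>P \<in> {Y, Z}. \<forall>i. \<exists>c b. \<forall>a \<in> P. \<forall>w \<in> Y \<union> Z.
        gdist E a w = enat i \<longrightarrow> c_num E i a w = c \<and> b_num E i a w = b)"

text \<open>
  One row \<open>k; c\<^sub>1, \<dots>, c\<^sub>d\<close> of an intersection array, for the vertices in the part \<open>P\<close> of a graph with
  vertex set \<open>V\<close>; the length \<open>d\<close> of the row is the eccentricity of these vertices.
\<close>

definition array_row ::
    "'v set \<Rightarrow> ('v \<times> 'v) set \<Rightarrow> 'v set \<Rightarrow> nat \<Rightarrow> nat list \<Rightarrow> bool" where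
  "array_row V E P k cs \<longleftrightarrow>
     (\<forall>a \<in> P. valency E a = k \<and> eccentricity V E a = enat (length cs) \<and>
        (\<forall>i \<in> {1..length cs}. \<forall>w \<in> V. gdist E a w = enat i \<longrightarrow> c_num E i a w = cs ! (i - 1)))"

definition has_intersection_array ::
    "'v set \<Rightarrow> 'v set \<Rightarrow> ('v \<times> 'v) set \<Rightarrow> nat \<Rightarrow> nat list \<Rightarrow> nat \<Rightarrow> nat list \<Rightarrow> bool" where
  "has_intersection_array Y Z E k cs l ds \<longleftrightarrow>
     array_row (Y \<union> Z) E Y k cs \<and> array_row (Y \<union> Z) E Z l ds"

text \<open>
  The plane at infinity of the affine space \<open>F\<^sup>3\<close>: its points and lines are the linear subspaces of
  dimension 1 and 2 (the directions of the affine lines and planes), incidence is inclusion.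
\<close>

definition inf_points :: "('a::field ^ 3) set set" where
  "inf_points = {P. vec.subspace P \<and> vec.dim P = 1}"

definition inf_lines :: "('a::field ^ 3) set set" where
  "inf_lines = {L. vec.subspace L \<and> vec.dim L = 2}"

text \<open>The intersection of (the projective closure of) an affine line or plane with the plane at infinity.\<close>

definition at_inf :: "('a::field ^ 3) set \<Rightarrow> ('a ^ 3) set" where
  "at_inf A = {v - u |u v. u \<in> A \<and> v \<in> A}"

definition affine_line :: "'a::field ^ 3 \<Rightarrow> 'a ^ 3 \<Rightarrow> ('a ^ 3) set" where
  "affine_line x y = {x + t *s (y - x) |t. True}"

definition affine_planes :: "('a::field ^ 3) set set" where
  "affine_planes = {(\<lambda>v. p + v) ` L |p L. L \<in> inf_lines}"

definition exterior :: "('a::field ^ 3) set set \<Rightarrow> ('a ^ 3) set \<Rightarrow> bool" where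
  "exterior H P \<longleftrightarrow> P \<in> inf_points \<and> \<not> (\<exists>L \<in> H. P \<subseteq> L)"

definition Y_points :: "('a::field ^ 3) set set \<Rightarrow> 'a ^ 3 \<Rightarrow> ('a ^ 3) set" where
  "Y_points H x = {y. y \<noteq> x \<and> exterior H (at_inf (affine_line x y))}"

definition Z_planes :: "('a::field ^ 3) set set \<Rightarrow> 'a ^ 3 \<Rightarrow> ('a ^ 3) set set" where
  "Z_planes H x = {A \<in> affine_planes. at_inf A \<in> H \<and> x \<notin> A}"

definition incidence_edges ::
    "'p set \<Rightarrow> 'p set set \<Rightarrow> (('p + 'p set) \<times> ('p + 'p set)) set" where
  "incidence_edges Y Z =
     {(Inl y, Inr A) |y A. y \<in> Y \<and> A \<in> Z \<and> y \<in> A} \<union>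
     {(Inr A, Inl y) |y A. y \<in> Y \<and> A \<in> Z \<and> y \<in> A}"

end

theory Submission
  imports Defs
begin

text \<open>
  Let \<open>S\<close> be a set of affine points not containing \<open>x\<close>. A point of \<open>S\<close> outside \<open>Y\<close> lies on exactly two of
  the planes \<open>x + L\<close> with \<open>L \<in> H\<close>, so \<open>|S - Y|\<close> is half the sum of the \<open>|S \<inter> (x + L)|\<close>. Applied to a plane
  in \<open>Z\<close>, which meets all but one of these planes in \<open>q\<close> points, this gives the valency \<open>q(q - 1)/2\<close>.
  Applied to the line in which two non-parallel planes of \<open>Z\<close> meet, it shows that this line contains
  \<open>q/2\<close> points of \<open>Y\<close>: the line has one point on each of the \<open>q\<close> planes \<open>x + L\<close> for which \<open>L\<close> is not the
  direction of either plane. The same double count around a point \<open>y \<in> Y\<close> instead of \<open>x\<close> gives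
  \<open>c\<^sub>3 = (q + 1)q/4\<close>.

  As to distances, two points of \<open>Y\<close> are at distance 2 or 4 according to whether their difference
  lies in a member of \<open>H\<close>, two planes according to whether they are non-parallel or parallel, and a
  point and a plane not incident with it are at distance 3.
\<close>

section \<open>Distances in bipartite graphs\<close>

text \<open>By \<open>edge\<close>, \<open>f\<close> grows by at most one per step, so every walk
  from \<open>a\<close> to \<open>v\<close> has length at least \<open>f v\<close>. Conversely,
  descending through \<open>pred\<close> until \<open>zero\<close> applies traces a walk of length
  \<open>f w\<close>.\<close>

lemma gdist_eqI:
  assumes "f a = 0" and "w \<in> V"
    and edge: "\<And>u v. (u, v) \<in> E \<Longrightarrow> f v \<le> f u + 1"
    and zero: "\<And>w. w \<in> V \<Longrightarrow> f w = 0 \<Longrightarrow> w = a"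
    and pred: "\<And>w. w \<in> V \<Longrightarrow> f w > 0 \<Longrightarrow> \<exists>u\<in>V. (u, w) \<in> E \<and> f u + 1 = f w"
  shows "gdist E a w = enat (f w)"
proof -
  have lower: "f v \<le> n" if "(a, v) \<in> E ^^ n" for n v
    using that
  proof (induction n arbitrary: v)
    case 0
    then show ?case using \<open>f a = 0\<close> by simp
  next
    case (Suc n)
    then obtain u where "(a, u) \<in> E ^^ n" "(u, v) \<in> E" by auto
    then show ?case using Suc.IH edge by fastforce
  qed
  have walk: "(a, v) \<in> E ^^ n" if "v \<in> V" "f v = n" for n v
    using that
  proof (induction n arbitrary: v)
    case 0
    then show ?case using zero by simp
  next
    case (Suc n)
    then obtain u where "u \<in> V" "(u, v) \<in> E" "f u = n" using pred[of v] by auto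
    then show ?case using Suc.IH by auto
  qed
  show ?thesis
    unfolding gdist_def
  proof (rule antisym)
    show "(INF n\<in>{n. (a, w) \<in> E ^^ n}. enat n) \<le> enat (f w)"
      using walk[OF \<open>w \<in> V\<close>] by (auto intro: INF_lower)
    show "enat (f w) \<le> (INF n\<in>{n. (a, w) \<in> E ^^ n}. enat n)"
      using lower by (auto intro: INF_greatest)
  qed
qed

text \<open>Since \<open>f\<close> changes by exactly one along each edge at \<open>w\<close>, every
  neighbour is counted by one of the two numbers. This makes \<open>b_num\<close> computable from
  \<open>c_num\<close>.\<close>

lemma c_num_add_b_num:
  assumes "finite {u. (w, u) \<in> E}"
    and dist: "\<And>u. (w, u) \<in> E \<Longrightarrow> gdist E a u = enat (f u)"
    and step: "\<And>u. (w, u) \<in> E \<Longrightarrow> f u = f w + 1 \<or> f w = f u + 1"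
  shows "c_num E (f w) a w + b_num E (f w) a w = valency E w"
proof -
  define C where "C = {u. (w, u) \<in> E \<and> f w = f u + 1}"
  define B where "B = {u. (w, u) \<in> E \<and> f u = f w + 1}"
  have "c_num E (f w) a w = card C"
    unfolding c_num_def C_def by (rule arg_cong[where f = card]) (auto simp: dist one_enat_def)
  moreover have "b_num E (f w) a w = card B"
    unfolding b_num_def B_def by (rule arg_cong[where f = card]) (auto simp: dist)
  moreover have "{u. (w, u) \<in> E} = C \<union> B"
    unfolding C_def B_def using step by blast
  moreover have "C \<inter> B = {}"
    unfolding C_def B_def by auto
  ultimately show ?thesis
    unfolding valency_def using assms(1) by (simp add: card_Un_disjoint)
qed

text \<open>The valency of \<open>w\<close> depends only on the parity of its distance from
  \<open>a\<close>, so once a row fixes the \<open>c_num\<close> values, the \<open>b_num\<close>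
  values are fixed as the complements.\<close>

lemma biregular_partI:
  assumes dist: "\<And>a w. a \<in> P \<Longrightarrow> w \<in> V \<Longrightarrow> gdist E a w = enat (f a w)"
    and edges: "E \<subseteq> V \<times> V" and "finite V"
    and step: "\<And>a u w. a \<in> P \<Longrightarrow> (w, u) \<in> E \<Longrightarrow> f a u = f a w + 1 \<or> f a w = f a u + 1"
    and val: "\<And>a w. a \<in> P \<Longrightarrow> w \<in> V \<Longrightarrow> valency E w = (if even (f a w) then k else l)"
    and row: "array_row V E P k cs"
  shows "\<exists>c b. \<forall>a\<in>P. \<forall>w\<in>V. gdist E a w = enat i \<longrightarrow> c_num E i a w = c \<and> b_num E i a w = b"
proof -
  \<comment> \<open>No vertex has distance -1, which gives 0 at \<open>i = 0\<close>; the list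
    \<open>cs\<close> starts with the entry for \<open>i = 1\<close>.\<close>
  define c where "c = (if i = 0 then 0 else cs ! (i - 1))"
  have "c_num E i a w = c \<and> b_num E i a w = (if even i then k else l) - c"
    if "a \<in> P" "w \<in> V" "gdist E a w = enat i" for a w
  proof -
    have fi: "f a w = i" using dist[OF that(1,2)] that(3) by simp
    \<comment> \<open>A row says nothing beyond its length, so the distance \<open>i\<close> must
      first be bounded by the eccentricity.\<close>
    have "enat i \<le> eccentricity V E a"
      unfolding eccentricity_def using SUP_upper[OF that(2), of "gdist E a"] that(3) by simp
    then have "i \<le> length cs" using row that(1) by (simp add: array_row_def)
    then have c: "c_num E i a w = c"
      using row that by (cases "i = 0") (auto simp: c_def array_row_def c_num_def zero_enat_def[symmetric])
    have "c_num E (f a w) a w + b_num E (f a w) a w = valency E w"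
    proof (rule c_num_add_b_num)
      show "finite {u. (w, u) \<in> E}"
        by (rule finite_subset[OF _ \<open>finite V\<close>]) (use edges in auto)
      show "gdist E a u = enat (f a u)" if "(w, u) \<in> E" for u
        using dist[OF \<open>a \<in> P\<close>] edges that by blast
      show "f a u = f a w + 1 \<or> f a w = f a u + 1" if "(w, u) \<in> E" for u
        using step[OF \<open>a \<in> P\<close> that] .
    qed
    then show ?thesis using c val[OF that(1,2)] fi by auto
  qed
  then show ?thesis by blast
qed

lemma array_rowI:
  assumes dist: "\<And>a w. a \<in> P \<Longrightarrow> w \<in> V \<Longrightarrow> gdist E a w = enat (f a w)"
    and edges: "E \<subseteq> V \<times> V"
    and "\<And>a. a \<in> P \<Longrightarrow> valency E a = k"
    and "\<And>a w. a \<in> P \<Longrightarrow> w \<in> V \<Longrightarrow> f a w \<le> length cs"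
    and "\<And>a. a \<in> P \<Longrightarrow> \<exists>w\<in>V. f a w = length cs"
    and c: "\<And>a w. a \<in> P \<Longrightarrow> w \<in> V \<Longrightarrow> f a w > 0 \<Longrightarrow>
          card {u. (w, u) \<in> E \<and> f a u + 1 = f a w} = cs ! (f a w - 1)"
  shows "array_row V E P k cs"
  unfolding array_row_def
proof (intro ballI conjI impI)
  fix a assume a: "a \<in> P"
  show "valency E a = k" using assms(3) a .
  show "eccentricity V E a = enat (length cs)"
    unfolding eccentricity_def
  proof (rule antisym)
    show "(SUP w\<in>V. gdist E a w) \<le> enat (length cs)"
      by (rule SUP_least) (simp add: dist[OF a] assms(4)[OF a])
    obtain w where "w \<in> V" "f a w = length cs" using assms(5)[OF a] by blast
    then show "enat (length cs) \<le> (SUP w\<in>V. gdist E a w)"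
      using SUP_upper[of w V "gdist E a"] dist[OF a] by simp
  qed
  fix i w assume i: "i \<in> {1..length cs}" and w: "w \<in> V" and g: "gdist E a w = enat i"
  then have fi: "f a w = i" using dist[OF a w] by simp
  have "c_num E i a w = card {u. (w, u) \<in> E \<and> f a u + 1 = f a w}"
    unfolding c_num_def
    by (rule arg_cong[where f = card]) (use edges in \<open>auto simp: dist[OF a] one_enat_def fi\<close>)
  also have "\<dots> = cs ! (i - 1)" using c[OF a w] fi i by simp
  finally show "c_num E i a w = cs ! (i - 1)" .
qed

section \<open>Incidence structures with parallel classes of blocks\<close>

text \<open>These are the counts that the geometry has to supply; the graph argument uses nothing
  else. \<open>cls\<close> stands for the parallel class of a block and will be
  \<open>at_inf\<close>. The parameters \<open>k\<close> and \<open>l\<close> are the valencies,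
  \<open>c\<close> is the third entry of the row for points, and \<open>\<mu>\<close> the second
  entry of the row for blocks.\<close>

locale parallel_incidence =
  fixes Y :: "'p set" and Z :: "'p set set" and cls :: "'p set \<Rightarrow> 'c"
    and k l c \<mu> :: nat
  assumes finite_Y: "finite Y" and finite_Z: "finite Z"
    and k_gt: "k > 1" and l_gt: "l > 0" and c_gt: "c > 0" and mu_gt: "\<mu> > 0"
    and blocks_through: "y \<in> Y \<Longrightarrow> card {A \<in> Z. y \<in> A} = k"
    and points_on: "A \<in> Z \<Longrightarrow> card {y \<in> Y. y \<in> A} = l"
    and blocks_through_two: "y \<in> Y \<Longrightarrow> y' \<in> Y \<Longrightarrow> y \<noteq> y' \<Longrightarrow>
          card {A \<in> Z. y \<in> A \<and> y' \<in> A} \<in> {0, 2}"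
    and collinear_on: "y \<in> Y \<Longrightarrow> A \<in> Z \<Longrightarrow> y \<notin> A \<Longrightarrow>
          card {y' \<in> Y. y' \<in> A \<and> (\<exists>B\<in>Z. y \<in> B \<and> y' \<in> B)} = c"
    and points_on_two: "A \<in> Z \<Longrightarrow> B \<in> Z \<Longrightarrow> cls A \<noteq> cls B \<Longrightarrow>
          card {y \<in> Y. y \<in> A \<and> y \<in> B} = \<mu>"
    and parallel_disjoint: "A \<in> Z \<Longrightarrow> B \<in> Z \<Longrightarrow> A \<noteq> B \<Longrightarrow> cls A = cls B \<Longrightarrow> y \<in> Y \<Longrightarrow>
          y \<in> A \<Longrightarrow> y \<notin> B"
    and nonparallel_through: "y \<in> Y \<Longrightarrow> A \<in> Z \<Longrightarrow>
          card {B \<in> Z. y \<in> B \<and> cls B \<noteq> cls A} = k - 1"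
    and ex_noncollinear: "y \<in> Y \<Longrightarrow> \<exists>y'\<in>Y. y' \<noteq> y \<and> (\<forall>A\<in>Z. y \<in> A \<longrightarrow> y' \<notin> A)"
    and ex_parallel: "A \<in> Z \<Longrightarrow> \<exists>B\<in>Z. B \<noteq> A \<and> cls B = cls A"
begin

section \<open>The incidence graph, its neighbourhoods and valencies\<close>

abbreviation "V \<equiv> Inl ` Y \<union> Inr ` Z"
abbreviation "G \<equiv> incidence_edges Y Z"

lemma G_simps [simp]:
  "(Inl y, Inr A) \<in> G \<longleftrightarrow> y \<in> Y \<and> A \<in> Z \<and> y \<in> A"
  "(Inr A, Inl y) \<in> G \<longleftrightarrow> y \<in> Y \<and> A \<in> Z \<and> y \<in> A"
  "(Inl y, Inl y') \<notin> G" "(Inr A, Inr B) \<notin> G"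
  by (auto simp: incidence_edges_def)

lemma G_cases:
  assumes "(u, v) \<in> G"
  obtains y A where "y \<in> Y" "A \<in> Z" "y \<in> A" "u = Inl y" "v = Inr A"
  | y A where "y \<in> Y" "A \<in> Z" "y \<in> A" "u = Inr A" "v = Inl y"
  using assms by (auto simp: incidence_edges_def)

lemma bipartite_G: "bipartite_graph (Inl ` Y) (Inr ` Z) G"
  by (auto simp: bipartite_graph_def finite_Y finite_Z incidence_edges_def sym_def)

lemma G_subset: "G \<subseteq> V \<times> V"
  by (auto simp: incidence_edges_def)

lemma finite_V: "finite V"
  by (simp add: finite_Y finite_Z)

lemma card_nbrs_Inl: "y \<in> Y \<Longrightarrow> card {u. (Inl y, u) \<in> G \<and> P u} = card {A \<in> Z. y \<in> A \<and> P (Inr A)}"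
proof -
  assume "y \<in> Y"
  then have "{u. (Inl y, u) \<in> G \<and> P u} = Inr ` {A \<in> Z. y \<in> A \<and> P (Inr A)}"
    by (auto elim!: G_cases)
  then show ?thesis by (simp add: card_image)
qed

lemma card_nbrs_Inr: "A \<in> Z \<Longrightarrow> card {u. (Inr A, u) \<in> G \<and> P u} = card {y \<in> Y. y \<in> A \<and> P (Inl y)}"
proof -
  assume "A \<in> Z"
  then have "{u. (Inr A, u) \<in> G \<and> P u} = Inl ` {y \<in> Y. y \<in> A \<and> P (Inl y)}"
    by (auto elim!: G_cases)
  then show ?thesis by (simp add: card_image)
qed

lemma valency_Inl: "y \<in> Y \<Longrightarrow> valency G (Inl y) = k"
  using card_nbrs_Inl[of y "\<lambda>_. True"] blocks_through by (simp add: valency_def)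

lemma valency_Inr: "A \<in> Z \<Longrightarrow> valency G (Inr A) = l"
  using card_nbrs_Inr[of A "\<lambda>_. True"] points_on by (simp add: valency_def)

section \<open>Existence statements obtained from positive counts\<close>

lemma ex_block: "y \<in> Y \<Longrightarrow> \<exists>A\<in>Z. y \<in> A"
  using blocks_through[of y] k_gt card_gt_0_iff[of "{A \<in> Z. y \<in> A}"] by auto

lemma ex_point: "A \<in> Z \<Longrightarrow> \<exists>y\<in>Y. y \<in> A"
  using points_on[of A] l_gt card_gt_0_iff[of "{y \<in> Y. y \<in> A}"] by auto

lemma ex_collinear: "y \<in> Y \<Longrightarrow> A \<in> Z \<Longrightarrow> y \<notin> A \<Longrightarrow> \<exists>y'\<in>Y. y' \<in> A \<and> (\<exists>B\<in>Z. y \<in> B \<and> y' \<in> B)"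
  using collinear_on[of y A] c_gt
    card_gt_0_iff[of "{y' \<in> Y. y' \<in> A \<and> (\<exists>B\<in>Z. y \<in> B \<and> y' \<in> B)}"] by auto

lemma ex_common_point: "A \<in> Z \<Longrightarrow> B \<in> Z \<Longrightarrow> cls A \<noteq> cls B \<Longrightarrow> \<exists>y\<in>Y. y \<in> A \<and> y \<in> B"
  using points_on_two[of A B] mu_gt card_gt_0_iff[of "{y \<in> Y. y \<in> A \<and> y \<in> B}"] by auto

lemma ex_nonparallel: "y \<in> Y \<Longrightarrow> A \<in> Z \<Longrightarrow> \<exists>B\<in>Z. y \<in> B \<and> cls B \<noteq> cls A"
  using nonparallel_through[of y A] k_gt
    card_gt_0_iff[of "{B \<in> Z. y \<in> B \<and> cls B \<noteq> cls A}"] by auto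

text \<open>Explicit candidates for the distances from a point and from a block, confirmed in
  \<open>gdist_Inl\<close> and \<open>gdist_Inr\<close>. The values 3 and 4 are defaults: that
  nothing is farther away follows from the positivity of the parameters.\<close>

fun dY :: "'p \<Rightarrow> 'p + 'p set \<Rightarrow> nat" where
  "dY y (Inl y') = (if y' = y then 0 else if \<exists>A\<in>Z. y \<in> A \<and> y' \<in> A then 2 else 4)"
| "dY y (Inr A) = (if y \<in> A then 1 else 3)"

fun dZ :: "'p set \<Rightarrow> 'p + 'p set \<Rightarrow> nat" where
  "dZ A (Inr B) = (if B = A then 0 else if cls B \<noteq> cls A then 2 else 4)"
| "dZ A (Inl y) = (if y \<in> A then 1 else 3)"

lemma dY_step: "y \<in> Y \<Longrightarrow> (w, u) \<in> G \<Longrightarrow> dY y u = dY y w + 1 \<or> dY y w = dY y u + 1"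
  by (auto elim!: G_cases split: if_splits)

text \<open>The jump to be excluded is the one between a point of \<open>A\<close>, with value 1,
  and a different block parallel to \<open>A\<close>, with value 4; \<open>parallel_disjoint\<close>
  rules out this incidence.\<close>

lemma dZ_step: "A \<in> Z \<Longrightarrow> (w, u) \<in> G \<Longrightarrow> dZ A u = dZ A w + 1 \<or> dZ A w = dZ A u + 1"
  by (auto elim!: G_cases split: if_splits dest: parallel_disjoint)

lemma gdist_Inl:
  assumes "y \<in> Y" "w \<in> V"
  shows "gdist G (Inl y) w = enat (dY y w)"
proof (rule gdist_eqI[where V = V])
  show "dY y v \<le> dY y u + 1" if "(u, v) \<in> G" for u v
    using dY_step[OF assms(1) that] by linarith
  show "v = Inl y" if "v \<in> V" "dY y v = 0" for v
    using that by (auto split: if_splits)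
  show "\<exists>u\<in>V. (u, v) \<in> G \<and> dY y u + 1 = dY y v" if "v \<in> V" "dY y v > 0" for v
    using that(1)
  proof
    assume "v \<in> Inl ` Y"
    then obtain y' where y': "v = Inl y'" "y' \<in> Y" by auto
    show ?thesis
    proof (cases "\<exists>A\<in>Z. y \<in> A \<and> y' \<in> A")
      case True
      then obtain A where "A \<in> Z" "y \<in> A" "y' \<in> A" by auto
      then show ?thesis using y' that(2) by (intro bexI[of _ "Inr A"]) auto
    next
      case False
      \<comment> \<open>Any block through \<open>y'\<close> serves: none of them contains
        \<open>y\<close>, so all have value 3.\<close>
      obtain A where "A \<in> Z" "y' \<in> A" using ex_block y' by auto
      then show ?thesis using False y' that(2) by (intro bexI[of _ "Inr A"]) auto
    qed
  next
    assume "v \<in> Inr ` Z"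
    then obtain A where A: "v = Inr A" "A \<in> Z" by auto
    show ?thesis
    proof (cases "y \<in> A")
      case True
      then show ?thesis using A assms by (intro bexI[of _ "Inl y"]) auto
    next
      case False
      then obtain y' where "y' \<in> Y" "y' \<in> A" "\<exists>B\<in>Z. y \<in> B \<and> y' \<in> B"
        using ex_collinear[OF assms(1) A(2)] by auto
      then show ?thesis using False A assms by (intro bexI[of _ "Inl y'"]) auto
    qed
  qed
qed (use assms in auto)

lemma gdist_Inr:
  assumes "A \<in> Z" "w \<in> V"
  shows "gdist G (Inr A) w = enat (dZ A w)"
proof (rule gdist_eqI[where V = V])
  show "dZ A v \<le> dZ A u + 1" if "(u, v) \<in> G" for u v
    using dZ_step[OF assms(1) that] by linarith
  show "v = Inr A" if "v \<in> V" "dZ A v = 0" for v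
    using that by (auto split: if_splits)
  show "\<exists>u\<in>V. (u, v) \<in> G \<and> dZ A u + 1 = dZ A v" if "v \<in> V" "dZ A v > 0" for v
    using that(1)
  proof
    assume "v \<in> Inr ` Z"
    then obtain B where B: "v = Inr B" "B \<in> Z" by auto
    show ?thesis
    proof (cases "cls B = cls A")
      case False
      then obtain y where "y \<in> Y" "y \<in> A" "y \<in> B" using ex_common_point assms B by metis
      then show ?thesis using B that(2) False by (intro bexI[of _ "Inl y"]) auto
    next
      case True
      \<comment> \<open>Any point of \<open>B\<close> serves, because a block parallel to
        \<open>A\<close> and different from it has no point of \<open>A\<close> in
        \<open>Y\<close>.\<close>
      obtain y where "y \<in> Y" "y \<in> B" using ex_point B by auto
      moreover have "y \<notin> A"
        using parallel_disjoint[of B A] calculation True B that(2) assms by (auto split: if_splits)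
      ultimately show ?thesis using True B that(2) by (intro bexI[of _ "Inl y"]) auto
    qed
  next
    assume "v \<in> Inl ` Y"
    then obtain y where y: "v = Inl y" "y \<in> Y" by auto
    show ?thesis
    proof (cases "y \<in> A")
      case True
      then show ?thesis using y assms by (intro bexI[of _ "Inr A"]) auto
    next
      case False
      then obtain B where "B \<in> Z" "y \<in> B" "cls B \<noteq> cls A"
        using ex_nonparallel[OF y(2) assms(1)] by auto
      then show ?thesis using False y assms by (intro bexI[of _ "Inr B"]) auto
    qed
  qed
qed (use assms in auto)

text \<open>Collinear points share a block, so of the values 0 and 2 in
  \<open>blocks_through_two\<close> only 2 remains. For a noncollinear point no block through it
  contains \<open>y\<close>, so all its \<open>k\<close> neighbours are at distance 3.\<close>

lemma array_row_Y: "array_row V G (Inl ` Y) k [1, 2, c, k]"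
proof (rule array_rowI[where f = "\<lambda>a. dY (projl a)"])
  fix a :: "'p + 'p set" assume "a \<in> Inl ` Y"
  then obtain y where a: "a = Inl y" "y \<in> Y" by auto
  show "gdist G a w = enat (dY (projl a) w)" if "w \<in> V" for w
    using gdist_Inl a that by simp
  show "valency G a = k" using a valency_Inl by simp
  show "dY (projl a) w \<le> length [1, 2, c, k]" for w by (cases w) auto
  obtain y' where "y' \<in> Y" "y' \<noteq> y" "\<forall>A\<in>Z. y \<in> A \<longrightarrow> y' \<notin> A"
    using ex_noncollinear a by blast
  then show "\<exists>w\<in>V. dY (projl a) w = length [1, 2, c, k]"
    by (intro bexI[of _ "Inl y'"]) (auto simp: a)
  fix w assume "w \<in> V" and pos: "dY (projl a) w > 0"
  then consider y' where "y' \<in> Y" "w = Inl y'" "y' \<noteq> y" | A where "A \<in> Z" "w = Inr A"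
    by (auto simp: a split: if_splits)
  then show "card {u. (w, u) \<in> G \<and> dY (projl a) u + 1 = dY (projl a) w}
      = [1, 2, c, k] ! (dY (projl a) w - 1)"
  proof cases
    case 1
    show ?thesis
    proof (cases "\<exists>A\<in>Z. y \<in> A \<and> y' \<in> A")
      case True
      have fin: "finite {A \<in> Z. y \<in> A \<and> y' \<in> A}" using finite_Z by simp
      have "card {A \<in> Z. y' \<in> A \<and> dY y (Inr A) + 1 = 2} = card {A \<in> Z. y \<in> A \<and> y' \<in> A}"
        by (rule arg_cong[where f = card]) auto
      also have "\<dots> = 2"
        using blocks_through_two[of y y'] True 1 a fin by auto
      finally show ?thesis using True 1 a
        by (simp add: card_nbrs_Inl del: dY.simps(2))
    next
      case False
      have "{A \<in> Z. y' \<in> A \<and> dY y (Inr A) + 1 = 4} = {A \<in> Z. y' \<in> A}"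
        using False by auto
      moreover have "dY y (Inl y') = 4" using False 1 by auto
      ultimately show ?thesis using 1 a blocks_through[of y']
        by (simp add: card_nbrs_Inl del: dY.simps)
    qed
  next
    case 2
    show ?thesis
    proof (cases "y \<in> A")
      case True
      have "{y' \<in> Y. y' \<in> A \<and> dY y (Inl y') + 1 = 1} = {y}"
        using True a by (auto split: if_splits)
      then show ?thesis using True 2 a
        by (simp add: card_nbrs_Inr del: dY.simps(1))
    next
      case False
      have "{y' \<in> Y. y' \<in> A \<and> dY y (Inl y') + 1 = 3}
          = {y' \<in> Y. y' \<in> A \<and> (\<exists>B\<in>Z. y \<in> B \<and> y' \<in> B)}"
        using False by (auto split: if_splits)
      then show ?thesis using False 2 a collinear_on[of y A]
        by (simp add: card_nbrs_Inr del: dY.simps(1))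
    qed
  qed
qed (rule G_subset)

text \<open>From a point off \<open>A\<close>, the neighbours closer to \<open>A\<close> are the
  blocks not parallel to \<open>A\<close>, which gives \<open>k - 1\<close>. All \<open>l\<close>
  points of a block parallel to \<open>A\<close> and different from it lie off \<open>A\<close>,
  hence at distance 3.\<close>

lemma array_row_Z: "array_row V G (Inr ` Z) l [1, \<mu>, k - 1, l]"
proof (rule array_rowI[where f = "\<lambda>a. dZ (projr a)"])
  fix a :: "'p + 'p set" assume "a \<in> Inr ` Z"
  then obtain A where a: "a = Inr A" "A \<in> Z" by auto
  show "gdist G a w = enat (dZ (projr a) w)" if "w \<in> V" for w
    using gdist_Inr a that by simp
  show "valency G a = l" using a valency_Inr by simp
  show "dZ (projr a) w \<le> length [1, \<mu>, k - 1, l]" for w by (cases w) auto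
  obtain B where "B \<in> Z" "B \<noteq> A" "cls B = cls A"
    using ex_parallel a by blast
  then show "\<exists>w\<in>V. dZ (projr a) w = length [1, \<mu>, k - 1, l]"
    by (intro bexI[of _ "Inr B"]) (auto simp: a)
  fix w assume "w \<in> V" and pos: "dZ (projr a) w > 0"
  then consider y where "y \<in> Y" "w = Inl y" | B where "B \<in> Z" "w = Inr B" "B \<noteq> A"
    by (auto simp: a split: if_splits)
  then show "card {u. (w, u) \<in> G \<and> dZ (projr a) u + 1 = dZ (projr a) w}
      = [1, \<mu>, k - 1, l] ! (dZ (projr a) w - 1)"
  proof cases
    case 1
    show ?thesis
    proof (cases "y \<in> A")
      case True
      have "{B \<in> Z. y \<in> B \<and> dZ A (Inr B) + 1 = 1} = {A}"
        using True a by (auto split: if_splits)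
      then show ?thesis using True 1 a
        by (simp add: card_nbrs_Inl del: dZ.simps(1))
    next
      case False
      have "{B \<in> Z. y \<in> B \<and> dZ A (Inr B) + 1 = 3} = {B \<in> Z. y \<in> B \<and> cls B \<noteq> cls A}"
        using False by (auto split: if_splits)
      then show ?thesis using False 1 a nonparallel_through[of y A]
        by (simp add: card_nbrs_Inl del: dZ.simps(1))
    qed
  next
    case 2
    show ?thesis
    proof (cases "cls B = cls A")
      case False
      have "{y \<in> Y. y \<in> B \<and> dZ A (Inl y) + 1 = 2} = {y \<in> Y. y \<in> B \<and> y \<in> A}"
        by auto
      then show ?thesis using False 2 a points_on_two[of B A]
        by (simp add: card_nbrs_Inr del: dZ.simps(2))
    next
      case True
      have "{y \<in> Y. y \<in> B \<and> dZ A (Inl y) + 1 = 4} = {y \<in> Y. y \<in> B}"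
        using True 2 a parallel_disjoint[of B A] by auto
      then show ?thesis using True 2 a points_on[of B]
        by (simp add: card_nbrs_Inr del: dZ.simps(2))
    qed
  qed
qed (rule G_subset)

theorem intersection_array:
  "distance_biregular (Inl ` Y) (Inr ` Z) G \<and>
   has_intersection_array (Inl ` Y) (Inr ` Z) G k [1, 2, c, k] l [1, \<mu>, k - 1, l]"
proof -
  have "\<exists>c b. \<forall>a\<in>Inl ` Y. \<forall>w\<in>V. gdist G a w = enat i \<longrightarrow> c_num G i a w = c \<and> b_num G i a w = b" for i
  proof (rule biregular_partI[where f = "\<lambda>a. dY (projl a)" and l = l,
        OF _ G_subset finite_V _ _ array_row_Y])
    show "valency G w = (if even (dY (projl a) w) then k else l)" if "a \<in> Inl ` Y" "w \<in> V"
      for a :: "'p + 'p set" and w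
      using that by (auto simp: valency_Inl valency_Inr split: if_splits)
    show "dY (projl a) u = dY (projl a) w + 1 \<or> dY (projl a) w = dY (projl a) u + 1"
      if "a \<in> Inl ` Y" "(w, u) \<in> G" for a :: "'p + 'p set" and u w
      using that dY_step by fastforce
  qed (use gdist_Inl in auto)
  moreover
  have "\<exists>c b. \<forall>a\<in>Inr ` Z. \<forall>w\<in>V. gdist G a w = enat i \<longrightarrow> c_num G i a w = c \<and> b_num G i a w = b" for i
  \<comment> \<open>The valencies trade places: the vertices at even distance from a block are
    blocks.\<close>
  proof (rule biregular_partI[where f = "\<lambda>a. dZ (projr a)" and l = k,
        OF _ G_subset finite_V _ _ array_row_Z])
    show "valency G w = (if even (dZ (projr a) w) then l else k)" if "a \<in> Inr ` Z" "w \<in> V"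
      for a :: "'p + 'p set" and w
      using that by (auto simp: valency_Inl valency_Inr split: if_splits)
    show "dZ (projr a) u = dZ (projr a) w + 1 \<or> dZ (projr a) w = dZ (projr a) u + 1"
      if "a \<in> Inr ` Z" "(w, u) \<in> G" for a :: "'p + 'p set" and u w
      using that dZ_step by fastforce
  qed (use gdist_Inr in auto)
  ultimately show ?thesis
    using bipartite_G array_row_Y array_row_Z
    by (simp add: distance_biregular_def has_intersection_array_def)
qed

end

section \<open>Cosets of subspaces over a finite field\<close>

lemma mem_coset_iff: "v \<in> (+) p ` L \<longleftrightarrow> v - p \<in> (L :: 'b::ab_group_add set)"
  by (force intro: image_eqI[of _ _ "v - p"])

lemma scale_mem_iff:
  fixes L :: "('a::field ^ 'n) set"
  assumes "vec.subspace L" "t \<noteq> 0"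
  shows "t *s v \<in> L \<longleftrightarrow> v \<in> L"
proof
  assume "t *s v \<in> L"
  then have "inverse t *s (t *s v) \<in> L" by (rule vec.subspace_scale[OF assms(1)])
  then show "v \<in> L" using assms(2) by (simp del: vector_smult_assoc add: vec.scale_scale)
qed (rule vec.subspace_scale[OF assms(1)])

lemma minus_mem_iff:
  fixes L :: "('a::field ^ 'n) set"
  assumes "vec.subspace L"
  shows "u - v \<in> L \<longleftrightarrow> v - u \<in> L"
  using vec.subspace_neg[OF assms, of "u - v"] vec.subspace_neg[OF assms, of "v - u"] by auto

lemma coset_eq_iff:
  fixes L :: "('a::field ^ 'n) set"
  assumes "vec.subspace L"
  shows "(+) p ` L = (+) r ` L \<longleftrightarrow> p - r \<in> L"
proof
  assume "(+) p ` L = (+) r ` L"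
  moreover have "p \<in> (+) p ` L" by (simp add: mem_coset_iff vec.subspace_0[OF assms])
  ultimately show "p - r \<in> L" using mem_coset_iff by blast
next
  assume pr: "p - r \<in> L"
  show "(+) p ` L = (+) r ` L"
  proof (rule set_eqI)
    fix v
    show "v \<in> (+) p ` L \<longleftrightarrow> v \<in> (+) r ` L"
      using vec.subspace_add[OF assms pr, of "v - p"] vec.subspace_diff[OF assms _ pr, of "v - r"]
      by (auto simp: mem_coset_iff)
  qed
qed

lemma card_coset: "card ((+) p ` L) = card (L :: 'b::ab_group_add set)"
  by (rule card_image) simp

text \<open>Adjoining \<open>b\<close> multiplies the size by \<open>CARD('a)\<close>: each vector
  of the larger span is \<open>t *s b + v\<close> for a unique scalar \<open>t\<close> and a unique
  \<open>v\<close> in the smaller span.\<close>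

lemma card_span_independent:
  fixes B :: "('a::{field,finite} ^ 'n) set"
  assumes "vec.independent B"
  shows "card (vec.span B) = CARD('a) ^ card B"
proof -
  have "finite B" by simp
  then show ?thesis using assms
  proof (induction B rule: finite_induct)
    case empty
    then show ?case by simp
  next
    case (insert b B)
    then have b: "b \<notin> vec.span B" and ind: "vec.independent B"
      by (auto simp: vec.independent_insert)
    have "bij_betw (\<lambda>(t, v). t *s b + v) (UNIV \<times> vec.span B) (vec.span (insert b B))"
      unfolding bij_betw_def
    proof
      show "inj_on (\<lambda>(t, v). t *s b + v) (UNIV \<times> vec.span B)"
      proof (rule inj_onI, clarify)
        fix t v s w assume vw: "v \<in> vec.span B" "w \<in> vec.span B" and eq: "t *s b + v = s *s b + w"
        have "(t - s) *s b = w - v" using eq by (simp add: vec.scale_left_diff_distrib algebra_simps)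
        then have "(t - s) *s b \<in> vec.span B" using vw by (simp add: vec.span_diff)
        then have "t = s" using b scale_mem_iff[of "vec.span B" "t - s" b] by auto
        then show "t = s \<and> v = w" using eq by simp
      qed
      show "(\<lambda>(t, v). t *s b + v) ` (UNIV \<times> vec.span B) = vec.span (insert b B)"
      proof (rule set_eqI)
        fix z
        have "z \<in> vec.span (insert b B) \<longleftrightarrow> (\<exists>t. z - t *s b \<in> vec.span B)"
          by (rule vec.span_breakdown_eq)
        also have "\<dots> \<longleftrightarrow> z \<in> (\<lambda>(t, v). t *s b + v) ` (UNIV \<times> vec.span B)"
        proof
          assume "\<exists>t. z - t *s b \<in> vec.span B"
          then obtain t where "z - t *s b \<in> vec.span B" by blast
          then show "z \<in> (\<lambda>(t, v). t *s b + v) ` (UNIV \<times> vec.span B)"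
            by (intro image_eqI[of _ _ "(t, z - t *s b)"]) auto
        next
          assume "z \<in> (\<lambda>(t, v). t *s b + v) ` (UNIV \<times> vec.span B)"
          then obtain t v where "z = t *s b + v" "v \<in> vec.span B" by auto
          then have "z - t *s b \<in> vec.span B" by simp
          then show "\<exists>t. z - t *s b \<in> vec.span B" ..
        qed
        finally show "z \<in> (\<lambda>(t, v). t *s b + v) ` (UNIV \<times> vec.span B) \<longleftrightarrow> z \<in> vec.span (insert b B)" by simp
      qed
    qed
    then have "card (vec.span (insert b B)) = CARD('a) * card (vec.span B)"
      by (metis bij_betw_same_card card_cartesian_product)
    then show ?case using insert ind by simp
  qed
qed

lemma card_subspace:
  fixes S :: "('a::{field,finite} ^ 'n) set"
  assumes "vec.subspace S"
  shows "card S = CARD('a) ^ vec.dim S"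
proof -
  obtain B where "B \<subseteq> S" "vec.independent B" "S \<subseteq> vec.span B" "card B = vec.dim S"
    using vec.basis_exists by blast
  moreover from this have "vec.span B = S" using assms by (metis vec.span_subspace)
  ultimately show ?thesis using card_span_independent by metis
qed

text \<open>A hyperplane \<open>S\<close> and a subspace \<open>T\<close> not inside it together
  span the whole space. Hence any two of their cosets meet, and they do so in a coset of
  \<open>S \<inter> T\<close>, whose dimension is one less than that of \<open>T\<close>.\<close>

lemma card_coset_Int:
  fixes S T :: "('a::{field,finite} ^ 'n) set"
  assumes S: "vec.subspace S" and T: "vec.subspace T" and "\<not> T \<subseteq> S" and "vec.dim S + 1 = CARD('n)"
  shows "card ((+) p ` S \<inter> (+) r ` T) = CARD('a) ^ (vec.dim T - 1)"
proof -
  define U where "U = {a + b | a b. a \<in> S \<and> b \<in> T}"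
  have U: "vec.subspace U" unfolding U_def by (rule vec.subspace_sums[OF S T])
  have "S \<subseteq> U" unfolding U_def using vec.subspace_0[OF T] by force
  moreover have "T \<subseteq> U" unfolding U_def using vec.subspace_0[OF S] by force
  ultimately have "S \<subset> U" using assms(3) by auto
  then have "vec.dim S < vec.dim U"
    using vec.dim_psubset[of S U] S U by (simp add: vec.span_eq_iff[THEN iffD2])
  moreover have "vec.dim U \<le> CARD('n)" using vec.dim_subset_UNIV[of U] by (simp add: vec.dimension_def card_cart_basis)
  ultimately have dU: "vec.dim U = CARD('n)" using assms(4) by simp
  then have "U = UNIV"
    using vec.dim_eq_full[of U] U by (simp add: vec.dimension_def card_cart_basis vec.span_eq_iff[THEN iffD2])
  \<comment> \<open>The decomposition exhibits the common point \<open>p + a = r - b\<close> of the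
    two cosets.\<close>
  then obtain a b where ab: "a \<in> S" "b \<in> T" "r - p = a + b" unfolding U_def by blast
  have "(+) p ` S \<inter> (+) r ` T = (+) (p + a) ` (S \<inter> T)"
  proof (rule set_eqI)
    fix v
    have "v - p \<in> S \<longleftrightarrow> v - (p + a) \<in> S"
      using vec.subspace_add[OF S _ ab(1), of "v - (p + a)"] vec.subspace_diff[OF S _ ab(1), of "v - p"]
      by (auto simp: algebra_simps)
    moreover have "v - (p + a) = v - r + b"
      using ab(3) by (simp add: algebra_simps)
    then have "v - r \<in> T \<longleftrightarrow> v - (p + a) \<in> T"
      unfolding \<open>v - (p + a) = v - r + b\<close>
      using vec.subspace_add[OF T _ ab(2), of "v - r"] vec.subspace_diff[OF T _ ab(2), of "v - r + b"]
      by auto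
    ultimately show "v \<in> (+) p ` S \<inter> (+) r ` T \<longleftrightarrow> v \<in> (+) (p + a) ` (S \<inter> T)"
      by (simp add: mem_coset_iff)
  qed
  then have "card ((+) p ` S \<inter> (+) r ` T) = CARD('a) ^ vec.dim (S \<inter> T)"
    by (simp add: card_coset card_subspace vec.subspace_inter S T)
  moreover have "vec.dim U + vec.dim (S \<inter> T) = vec.dim S + vec.dim T"
    unfolding U_def by (rule vec.dim_sums_Int[OF S T])
  then have "vec.dim (S \<inter> T) = vec.dim T - 1" using dU assms(4) by linarith
  ultimately show ?thesis by simp
qed

section \<open>Directions of affine lines and planes\<close>

lemma at_inf_coset:
  assumes "vec.subspace L"
  shows "at_inf ((+) p ` L) = L"
proof
  show "at_inf ((+) p ` L) \<subseteq> L"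
    using vec.subspace_diff[OF assms] by (auto simp: at_inf_def)
  show "L \<subseteq> at_inf ((+) p ` L)"
  proof
    fix v assume "v \<in> L"
    then have "v = (p + v) - (p + 0)" "p + v \<in> (+) p ` L" "p + 0 \<in> (+) p ` L"
      using vec.subspace_0[OF assms] by auto
    then show "v \<in> at_inf ((+) p ` L)" unfolding at_inf_def by blast
  qed
qed

lemma affine_line_eq_coset: "affine_line x y = (+) x ` vec.span {y - x}"
  by (auto simp: affine_line_def vec.span_singleton)

lemma span_in_inf_points: "v \<noteq> 0 \<Longrightarrow> vec.span {v} \<in> inf_points"
  by (simp add: inf_points_def vec.dim_span vec.dim_eq_card_independent)

lemma span_singleton_subset_iff: "vec.subspace L \<Longrightarrow> vec.span {v} \<subseteq> L \<longleftrightarrow> v \<in> L"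
  using vec.span_minimal[of "{v}" L] vec.span_base[of v "{v}"] by auto


section \<open>Dual hyperovals\<close>

text \<open>The counts below are stated for doubled or quadrupled cardinalities, which shows that
  the divisions in the array are exact.\<close>

locale dual_hyperoval =
  fixes H :: "('a::{field,finite} ^ 3) set set" and x :: "'a ^ 3"
  assumes H_lines: "H \<subseteq> inf_lines"
    and card_H: "card H = CARD('a) + 2"
    and zero_or_two: "P \<in> inf_points \<Longrightarrow> card {L \<in> H. P \<subseteq> L} \<in> {0, 2}"
    and q_gt: "CARD('a) > 2"
begin

abbreviation "Y \<equiv> Y_points H x"
abbreviation "Z \<equiv> Z_planes H x"

lemma subspace_H: "L \<in> H \<Longrightarrow> vec.subspace L"
  and dim_H: "L \<in> H \<Longrightarrow> vec.dim L = 2"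
  using H_lines by (auto simp: inf_lines_def)

lemma not_subset_H: "L \<in> H \<Longrightarrow> L' \<in> H \<Longrightarrow> L \<noteq> L' \<Longrightarrow> \<not> L' \<subseteq> L"
  using vec.subspace_dim_equal[of L' L] subspace_H dim_H by auto

lemma zero_or_two_mem:
  assumes "v \<noteq> 0"
  shows "card {L \<in> H. v \<in> L} \<in> {0, 2}"
proof -
  have "{L \<in> H. v \<in> L} = {L \<in> H. vec.span {v} \<subseteq> L}"
    using span_singleton_subset_iff subspace_H by blast
  then show ?thesis using zero_or_two span_in_inf_points[OF assms] by simp
qed

lemma H_nonempty: "H \<noteq> {}"
  using card_H by auto

text \<open>Exteriority becomes avoidance of all the planes \<open>x + L\<close>. The point
  \<open>x\<close> itself fits in, since 0 lies in every member of the nonempty set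
  \<open>H\<close>.\<close>

lemma mem_Y_iff: "y \<in> Y \<longleftrightarrow> (\<forall>L\<in>H. y - x \<notin> L)"
proof (cases "y = x")
  case True
  then show ?thesis using H_nonempty subspace_H vec.subspace_0 by (auto simp: Y_points_def)
next
  case False
  then have "at_inf (affine_line x y) = vec.span {y - x}" "vec.span {y - x} \<in> inf_points"
    by (simp_all add: affine_line_eq_coset at_inf_coset span_in_inf_points)
  then show ?thesis
    using False by (simp add: Y_points_def exterior_def span_singleton_subset_iff subspace_H)
qed

lemma Z_eq: "Z = {(+) p ` L |p L. L \<in> H \<and> p - x \<notin> L}"
proof -
  have "(+) p ` L \<in> Z \<longleftrightarrow> L \<in> H \<and> p - x \<notin> L" if "L \<in> inf_lines" for p L
  proof -
    have "vec.subspace L" using that by (simp add: inf_lines_def)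
    then show ?thesis
      using that by (auto simp: Z_planes_def affine_planes_def at_inf_coset mem_coset_iff minus_mem_iff)
  qed
  then show ?thesis using H_lines by (fastforce simp: Z_planes_def affine_planes_def)
qed

text \<open>Counts the pairs of a point \<open>v\<close> in \<open>S\<close> and an \<open>L\<close>
  in \<open>H\<close> with \<open>v - r \<in> L\<close>. As \<open>r \<notin> S\<close>, the vector
  \<open>v - r\<close> is nonzero, so it lies in two members of \<open>H\<close> as soon as it lies
  in one. The centre \<open>r\<close> is left free because both \<open>x\<close> and a point of
  \<open>Y\<close> are needed.\<close>

lemma double_count:
  assumes "r \<notin> S"
  shows "2 * card {v \<in> S. \<exists>L\<in>H. v - r \<in> L} = (\<Sum>L\<in>H. card (S \<inter> (+) r ` L))"
proof -
  define T where "T = {v \<in> S. \<exists>L\<in>H. v - r \<in> L}"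
  have "card {L \<in> H. v - r \<in> L} = 2" if "v \<in> T" for v
  proof -
    have "v - r \<noteq> 0" "{L \<in> H. v - r \<in> L} \<noteq> {}" using that assms by (auto simp: T_def)
    then show ?thesis using zero_or_two_mem[of "v - r"] by (auto simp: card_eq_0_iff)
  qed
  then have "(\<Sum>L\<in>H. card {v \<in> T. v - r \<in> L}) = 2 * card T"
    by (intro sum_multicount) auto
  moreover have "{v \<in> T. v - r \<in> L} = S \<inter> (+) r ` L" if "L \<in> H" for L
    using that by (auto simp: T_def mem_coset_iff)
  ultimately show ?thesis by (simp add: T_def)
qed

lemma card_Y_Int:
  assumes "x \<notin> S"
  shows "2 * card (Y \<inter> S) + (\<Sum>L\<in>H. card (S \<inter> (+) x ` L)) = 2 * card S"
proof -
  define T where "T = {v \<in> S. \<exists>L\<in>H. v - x \<in> L}"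
  have "S = (Y \<inter> S) \<union> T" "(Y \<inter> S) \<inter> T = {}"
    by (auto simp: T_def mem_Y_iff)
  then have "card S = card (Y \<inter> S) + card T"
    using card_Un_disjoint[of "Y \<inter> S" T] by simp
  then show ?thesis using double_count[OF assms] by (simp add: T_def)
qed

section \<open>Intersections of planes with directions in \<open>H\<close>\<close>

lemma card_planes_Int:
  assumes "L \<in> H" "L' \<in> H" "L \<noteq> L'"
  shows "card ((+) p ` L \<inter> (+) r ` L') = CARD('a)"
  using card_coset_Int[of L L' p r] assms subspace_H dim_H not_subset_H by simp

lemma parallel_planes_disjoint:
  assumes "L \<in> H" "p - r \<notin> L"
  shows "(+) p ` L \<inter> (+) r ` L = {}"
proof -
  have False if "v - p \<in> L" "v - r \<in> L" for v
    using vec.subspace_diff[OF subspace_H[OF assms(1)] that(2,1)] assms(2) by simp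
  then show ?thesis by (auto simp: mem_coset_iff disjoint_iff)
qed

text \<open>The dimension is read off by comparing the two expressions for the cardinality as powers
  of \<open>CARD('a)\<close>.\<close>

lemma dim_H_Int:
  assumes "L \<in> H" "L' \<in> H" "L \<noteq> L'"
  shows "vec.dim (L \<inter> L') = 1"
proof -
  have "card (L \<inter> L') = CARD('a)" using card_planes_Int[OF assms, of 0 0] by simp
  moreover have "card (L \<inter> L') = CARD('a) ^ vec.dim (L \<inter> L')"
    by (rule card_subspace) (use assms subspace_H vec.subspace_inter in auto)
  ultimately have "CARD('a) ^ vec.dim (L \<inter> L') = CARD('a) ^ 1" by simp
  then show ?thesis using q_gt power_inject_exp[of "CARD('a)" "vec.dim (L \<inter> L')" 1] by linarith
qed

text \<open>A nonzero vector of \<open>L \<inter> L'\<close> already lies in two members of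
  \<open>H\<close>; a third would contradict \<open>zero_or_two_mem\<close>.\<close>

lemma H_Int_not_subset:
  assumes "L \<in> H" "L' \<in> H" "L \<noteq> L'" "L'' \<in> H" "L'' \<noteq> L" "L'' \<noteq> L'"
  shows "\<not> L \<inter> L' \<subseteq> L''"
proof
  assume sub: "L \<inter> L' \<subseteq> L''"
  have "\<not> L \<inter> L' \<subseteq> {0}" using dim_H_Int[OF assms(1-3)] vec.dim_eq_0[of "L \<inter> L'"] by simp
  then obtain m where m: "m \<noteq> 0" "m \<in> L" "m \<in> L'" by blast
  have "card {L, L', L''} \<le> card {L \<in> H. m \<in> L}"
    by (rule card_mono) (use assms m sub in auto)
  moreover have "card {L, L', L''} = 3" using assms(3,5,6) by simp
  ultimately show False using zero_or_two_mem[OF m(1)] by (elim insertE emptyE; linarith)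
qed

lemma card_Y_line:
  assumes L: "L \<in> H" "L' \<in> H" "L \<noteq> L'" and p: "p - x \<notin> L" and r: "r - x \<notin> L'"
  shows "2 * card (Y \<inter> ((+) p ` L \<inter> (+) r ` L')) = CARD('a)"
proof -
  define S where "S = (+) p ` L \<inter> (+) r ` L'"
  have cS: "card S = CARD('a)" unfolding S_def by (rule card_planes_Int[OF L])
  \<comment> \<open>Moving the base points of both planes to a common point \<open>s\<close>
    presents \<open>S\<close> as a coset of the one-dimensional \<open>L \<inter> L'\<close>, to
    which \<open>card_coset_Int\<close> applies.\<close>
  then obtain s where s: "s \<in> S" by fastforce
  have "(+) p ` L = (+) s ` L" "(+) r ` L' = (+) s ` L'"
    using s L by (auto simp: S_def mem_coset_iff coset_eq_iff subspace_H minus_mem_iff)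
  then have S_eq: "S = (+) s ` (L \<inter> L')" by (auto simp: S_def mem_coset_iff)
  have "card (S \<inter> (+) x ` L'') = (if L'' \<in> {L, L'} then 0 else 1)" if "L'' \<in> H" for L''
  proof (cases "L'' \<in> {L, L'}")
    case True
    then have "S \<inter> (+) x ` L'' = {}"
      using parallel_planes_disjoint[OF L(1) p] parallel_planes_disjoint[OF L(2) r]
      by (auto simp: S_def)
    then show ?thesis using True by simp
  next
    case False
    \<comment> \<open>The exponent is 0: a line not parallel to a plane meets it in one
      point.\<close>
    then have "card ((+) x ` L'' \<inter> (+) s ` (L \<inter> L')) = CARD('a) ^ (vec.dim (L \<inter> L') - 1)"
      using card_coset_Int[of L'' "L \<inter> L'" x s] H_Int_not_subset[OF L that] that L
      by (auto simp: subspace_H vec.subspace_inter dim_H)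
    then show ?thesis using False dim_H_Int[OF L] by (simp add: S_eq Int_commute)
  qed
  then have "(\<Sum>L''\<in>H. card (S \<inter> (+) x ` L'')) = (\<Sum>L''\<in>H. if L'' \<in> {L, L'} then 0 else 1)"
    by (rule sum.cong[OF refl])
  also have "\<dots> = card (H - {L, L'})"
    by (auto simp: sum.If_cases intro!: arg_cong[where f = card])
  also have "\<dots> = CARD('a)" using L card_H by (simp add: card_Diff_subset)
  finally have "(\<Sum>L''\<in>H. card (S \<inter> (+) x ` L'')) = CARD('a)" .
  moreover have "x \<notin> S"
    using p L by (simp add: S_def mem_coset_iff minus_mem_iff subspace_H)
  ultimately show ?thesis using card_Y_Int[of S] cS by (simp add: S_def)
qed

lemma card_Y_plane:
  assumes L: "L \<in> H" and p: "p - x \<notin> L"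
  shows "2 * card (Y \<inter> (+) p ` L) = CARD('a) * (CARD('a) - 1)"
proof -
  have "card ((+) p ` L \<inter> (+) x ` L') = (if L' = L then 0 else CARD('a))" if "L' \<in> H" for L'
    using parallel_planes_disjoint[OF L p] card_planes_Int[OF L that] by auto
  then have "(\<Sum>L'\<in>H. card ((+) p ` L \<inter> (+) x ` L')) = (\<Sum>L'\<in>H. if L' = L then 0 else CARD('a))"
    by (rule sum.cong[OF refl])
  also have "\<dots> = (\<Sum>L'\<in>H - {L}. CARD('a))"
    using L by (subst sum.remove[of H L]) auto
  also have "\<dots> = (CARD('a) + 1) * CARD('a)" using L card_H by simp
  finally have "(\<Sum>L'\<in>H. card ((+) p ` L \<inter> (+) x ` L')) = (CARD('a) + 1) * CARD('a)" .
  moreover have "card ((+) p ` L) = CARD('a) * CARD('a)"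
    by (simp add: card_coset card_subspace subspace_H dim_H L power2_eq_square)
  moreover have "x \<notin> (+) p ` L" using p L by (simp add: mem_coset_iff minus_mem_iff subspace_H)
  \<comment> \<open>With q for \<open>CARD('a)\<close>, the claim is now the identity 2 q^2 - (q +
    1) q = q (q - 1).\<close>
  ultimately have "2 * card (Y \<inter> (+) p ` L) + (CARD('a) + 1) * CARD('a) = 2 * (CARD('a) * CARD('a))"
    using card_Y_Int by metis
  then show ?thesis by (simp add: algebra_simps)
qed

text \<open>Double counting around \<open>y\<close>: each \<open>L' \<noteq> L\<close> contributes
  the line where \<open>y + L'\<close> meets the given plane. Both planes miss \<open>x\<close>, so
  \<open>card_Y_line\<close> gives half of \<open>CARD('a)\<close> points of \<open>Y\<close> on it.
  The direction \<open>L\<close> contributes nothing, since \<open>y\<close> is off the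
  plane.\<close>

lemma card_collinear:
  assumes L: "L \<in> H" and p: "p - x \<notin> L" and y: "y \<in> Y" "y \<notin> (+) p ` L"
  shows "4 * card {v \<in> Y \<inter> (+) p ` L. \<exists>L'\<in>H. v - y \<in> L'} = (CARD('a) + 1) * CARD('a)"
proof -
  have "2 * card (Y \<inter> (+) p ` L \<inter> (+) y ` L') = (if L' = L then 0 else CARD('a))" if "L' \<in> H" for L'
    using parallel_planes_disjoint[OF L, of p y] card_Y_line[OF L that _ p, of y] y that L
    by (auto simp: mem_Y_iff mem_coset_iff minus_mem_iff subspace_H Int_assoc)
  then have "(\<Sum>L'\<in>H. 2 * card (Y \<inter> (+) p ` L \<inter> (+) y ` L')) = (\<Sum>L'\<in>H. if L' = L then 0 else CARD('a))"
    by (rule sum.cong[OF refl])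
  also have "\<dots> = (\<Sum>L'\<in>H - {L}. CARD('a))"
    using L by (subst sum.remove[of H L]) auto
  also have "\<dots> = (CARD('a) + 1) * CARD('a)" using L card_H by simp
  finally show ?thesis
    using double_count[of y "Y \<inter> (+) p ` L"] y by (simp add: sum_distrib_left[symmetric])
qed

text \<open>A plane through \<open>y\<close> is determined by its direction, and
  \<open>y \<in> Y\<close> ensures that every \<open>y + L\<close> with \<open>L \<in> H\<close>
  misses \<open>x\<close>. The predicate \<open>P\<close> lets this one bijection count all planes,
  those through a second point, and those not parallel to a given one.\<close>

lemma card_blocks_through:
  assumes "y \<in> Y"
  shows "card {A \<in> Z. y \<in> A \<and> P A} = card {L \<in> H. P ((+) y ` L)}"
proof -
  have "{A \<in> Z. y \<in> A \<and> P A} = (\<lambda>L. (+) y ` L) ` {L \<in> H. P ((+) y ` L)}" (is "?l = ?r")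
  proof
    show "?l \<subseteq> ?r"
    proof clarify
      fix A assume A: "A \<in> Z" "y \<in> A" "P A"
      then obtain p L where pL: "A = (+) p ` L" "L \<in> H" "p - x \<notin> L" unfolding Z_eq by blast
      then have "A = (+) y ` L"
        using A(2) by (simp add: mem_coset_iff coset_eq_iff subspace_H minus_mem_iff)
      then show "A \<in> ?r" using pL A by blast
    qed
    show "?r \<subseteq> ?l"
      using assms by (auto simp: Z_eq mem_Y_iff mem_coset_iff subspace_H vec.subspace_0)
  qed
  moreover have "inj_on (\<lambda>L. (+) y ` L) {L \<in> H. P ((+) y ` L)}"
    by (rule inj_on_inverseI[where g = at_inf]) (simp add: at_inf_coset subspace_H)
  ultimately show ?thesis by (simp add: card_image)
qed

lemma collinear_iff:
  assumes "y \<in> Y"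
  shows "(\<exists>A\<in>Z. y \<in> A \<and> v \<in> A) \<longleftrightarrow> (\<exists>L\<in>H. v - y \<in> L)"
proof -
  have "card {A \<in> Z. y \<in> A \<and> v \<in> A} = card {L \<in> H. v - y \<in> L}"
    using card_blocks_through[OF assms, of "\<lambda>A. v \<in> A"] by (simp add: mem_coset_iff)
  then have "{A \<in> Z. y \<in> A \<and> v \<in> A} = {} \<longleftrightarrow> {L \<in> H. v - y \<in> L} = {}"
    using card_eq_0_iff[of "{A \<in> Z. y \<in> A \<and> v \<in> A}"] card_eq_0_iff[of "{L \<in> H. v - y \<in> L}"]
    by simp
  then show ?thesis by blast
qed

text \<open>Scaling from \<open>x\<close> by such a factor will produce a noncollinear point and a
  parallel plane, the vertices at distance 4.\<close>

lemma ex_scalar: "\<exists>t :: 'a. t \<noteq> 0 \<and> t \<noteq> 1"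
proof (rule ccontr)
  assume "\<not> ?thesis"
  then have "(UNIV :: 'a set) \<subseteq> {0, 1}" by auto
  then have "CARD('a) \<le> card {0, 1 :: 'a}" by (intro card_mono) auto
  then show False using q_gt by (simp add: card_insert_if split: if_splits)
qed

lemma parallel_incidence:
  "parallel_incidence Y Z at_inf (CARD('a) + 2) (CARD('a) * (CARD('a) - 1) div 2)
     ((CARD('a) + 1) * CARD('a) div 4) (CARD('a) div 2)"
proof
  show "finite Y" "finite Z" by simp_all
  show "CARD('a) + 2 > 1" "CARD('a) div 2 > 0" using q_gt by simp_all
  \<comment> \<open>This bound and the next keep the quotients by 2 and 4 positive.\<close>
  have "3 * 2 \<le> CARD('a) * (CARD('a) - 1)" by (rule mult_le_mono) (use q_gt in auto)
  then show "CARD('a) * (CARD('a) - 1) div 2 > 0" by simp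
  have "4 * 3 \<le> (CARD('a) + 1) * CARD('a)" by (rule mult_le_mono) (use q_gt in auto)
  then show "(CARD('a) + 1) * CARD('a) div 4 > 0" by simp
next
  fix y assume y: "y \<in> Y"
  show "card {A \<in> Z. y \<in> A} = CARD('a) + 2"
    using card_blocks_through[OF y, of "\<lambda>_. True"] card_H by simp
  obtain t :: 'a where t: "t \<noteq> 0" "t \<noteq> 1" using ex_scalar by blast
  \<comment> \<open>The third point on the line through \<open>x\<close> and \<open>y\<close>: its
    differences from \<open>x\<close> and from \<open>y\<close> are nonzero multiples of
    \<open>y - x\<close>, which lies in no member of \<open>H\<close>.\<close>
  define y' where "y' = x + t *s (y - x)"
  have "y' - x = t *s (y - x)" "y' - y = (t - 1) *s (y - x)"
    by (simp_all add: y'_def vec.scale_left_diff_distrib)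
  then have *: "y' - x \<notin> L" "y' - y \<notin> L" if "L \<in> H" for L
    using that y t by (simp_all add: mem_Y_iff scale_mem_iff subspace_H)
  then have "y' \<in> Y" by (simp add: mem_Y_iff)
  moreover have "\<not> (\<exists>A\<in>Z. y \<in> A \<and> y' \<in> A)" using collinear_iff[OF y] * by blast
  moreover obtain L where L: "L \<in> H" using H_nonempty by blast
  have "y' \<noteq> y" using *(2)[OF L] vec.subspace_0[OF subspace_H[OF L]] by auto
  ultimately show "\<exists>y'\<in>Y. y' \<noteq> y \<and> (\<forall>A\<in>Z. y \<in> A \<longrightarrow> y' \<notin> A)" by blast
next
  fix A assume "A \<in> Z"
  then obtain p L where A: "A = (+) p ` L" "L \<in> H" "p - x \<notin> L" unfolding Z_eq by blast
  have "{y \<in> Y. y \<in> A} = Y \<inter> (+) p ` L" using A by blast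
  then show "card {y \<in> Y. y \<in> A} = CARD('a) * (CARD('a) - 1) div 2"
    using card_Y_plane[OF A(2,3)] by simp
  obtain t :: 'a where t: "t \<noteq> 0" "t \<noteq> 1" using ex_scalar by blast
  \<comment> \<open>The same scaling applied to \<open>p\<close> moves the plane to a parallel one
    that still misses \<open>x\<close>.\<close>
  define r where "r = x + t *s (p - x)"
  have "r - x = t *s (p - x)" "r - p = (t - 1) *s (p - x)"
    by (simp_all add: r_def vec.scale_left_diff_distrib)
  then have "r - x \<notin> L" "r - p \<notin> L"
    using A t by (simp_all add: scale_mem_iff subspace_H)
  then have "(+) r ` L \<in> Z" "(+) r ` L \<noteq> A" "at_inf ((+) r ` L) = at_inf A"
    using A by (auto simp: Z_eq coset_eq_iff at_inf_coset subspace_H)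
  then show "\<exists>B\<in>Z. B \<noteq> A \<and> at_inf B = at_inf A" by blast
next
  fix y y' assume y: "y \<in> Y" "y' \<in> Y" "y \<noteq> y'"
  show "card {A \<in> Z. y \<in> A \<and> y' \<in> A} \<in> {0, 2}"
    using card_blocks_through[OF y(1), of "\<lambda>A. y' \<in> A"] zero_or_two_mem[of "y' - y"] y(3)
    by (simp add: mem_coset_iff)
next
  fix y A assume y: "y \<in> Y" and AZ: "A \<in> Z"
  then obtain p L where A: "A = (+) p ` L" "L \<in> H" "p - x \<notin> L" unfolding Z_eq by blast
  have "{L' \<in> H. at_inf ((+) y ` L') \<noteq> at_inf A} = H - {L}"
    using A by (auto simp: at_inf_coset subspace_H)
  then show "card {B \<in> Z. y \<in> B \<and> at_inf B \<noteq> at_inf A} = CARD('a) + 2 - 1"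
    using card_blocks_through[OF y, of "\<lambda>B. at_inf B \<noteq> at_inf A"] A card_H by simp
  assume "y \<notin> A"
  moreover have "{v \<in> Y. v \<in> A \<and> (\<exists>B\<in>Z. y \<in> B \<and> v \<in> B)}
      = {v \<in> Y \<inter> (+) p ` L. \<exists>L'\<in>H. v - y \<in> L'}"
    using collinear_iff[OF y] A by auto
  ultimately show "card {v \<in> Y. v \<in> A \<and> (\<exists>B\<in>Z. y \<in> B \<and> v \<in> B)} = (CARD('a) + 1) * CARD('a) div 4"
    using card_collinear[OF A(2,3) y] A by simp
next
  fix A B assume "A \<in> Z" "B \<in> Z"
  then obtain p L r L' where A: "A = (+) p ` L" "L \<in> H" "p - x \<notin> L"
    and B: "B = (+) r ` L'" "L' \<in> H" "r - x \<notin> L'" unfolding Z_eq by blast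
  have at_inf: "at_inf A = L" "at_inf B = L'" using A B by (simp_all add: at_inf_coset subspace_H)
  show "card {y \<in> Y. y \<in> A \<and> y \<in> B} = CARD('a) div 2" if "at_inf A \<noteq> at_inf B"
  proof -
    have "{y \<in> Y. y \<in> A \<and> y \<in> B} = Y \<inter> ((+) p ` L \<inter> (+) r ` L')" using A B by blast
    then show ?thesis using card_Y_line[of L L' p r] A B that at_inf by simp
  qed
  show "y \<notin> B" if "A \<noteq> B" "at_inf A = at_inf B" "y \<in> A" for y
    using that at_inf parallel_planes_disjoint[of L p r] A B
    by (auto simp: coset_eq_iff subspace_H)
qed

end

theorem theorem6p4:
  fixes x :: "'a::{field,finite} ^ 3"
    and H :: "('a ^ 3) set set"
    and q m :: nat
  assumes "m \<ge> 2" and "q = 2 ^ m" and "CARD('a) = q"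
    and "H \<subseteq> inf_lines" and "card H = q + 2"
    and "\<And>P. P \<in> inf_points \<Longrightarrow> card {L \<in> H. P \<subseteq> L} \<in> {0, 2}"
  defines "Y \<equiv> Inl ` Y_points H x"
    and "Z \<equiv> Inr ` Z_planes H x"
    and "G \<equiv> incidence_edges (Y_points H x) (Z_planes H x)"
  shows "distance_biregular Y Z G \<and>
    has_intersection_array Y Z G
      (q + 2) [1, 2, (q + 1) * q div 4, q + 2]
      (q * (q - 1) div 2) [1, q div 2, q + 1, q * (q - 1) div 2]"
proof -
  have "CARD('a) > 2"
    using assms(1-3) power_increasing[of 2 m "2::nat"] by simp
  then interpret dual_hyperoval H x
    by unfold_locales (use assms in auto)
  show ?thesis
    \<comment> \<open>The abstract entry \<open>k - 1\<close> arrives as \<open>q + 2 - 1\<close>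
      and simplifies to \<open>q + 1\<close>.\<close>
    using parallel_incidence.intersection_array[OF parallel_incidence]
    unfolding Y_def Z_def G_def by (simp only: assms(3)) simp
qed

end
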